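(* For an integer $k\ge2$, let $H$ be a $k$-uniform hypergraph with $n$ vertices and $p\binom nk$ edges, where $0<p<1$. Then $$\operatorname{grdisc}(H)\le\begin{cases}\dfrac{1+p}{2}\dbinom{n-1}{k-1}, & 0<p<\frac13,\\[6pt] \max\{p,1-p\}\dbinom{n-1}{k-1}, & \frac13\le p\le\frac23,\\[6pt] \left(1-\dfrac p2\right)\dbinom{n-1}{k-1}, & \frac23<p<1.\end{cases}$$ Consequently, the function $c(p,n)$ (for $k$-uniform hypergraphs) satisfies $$c(p,n)\le\begin{cases}\dfrac{1+p}{2}\dbinom{n-1}{k-1}, & 0<p<\frac13,\\[6pt] \max\{p,1-p\}\dbinom{n-1}{k-1}, & \frac13\le p\le\frac23,\\[6pt] \left(1-\dfrac p2\right)\dbinom{n-1}{k-1}, & \frac23<p<1.\end{cases}$$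
   Context: A $k$-uniform hypergraph $H$ consists of a finite vertex set $V(H)$ and a set of $k$-element subsets of $V(H)$, called edges; here $n=|V(H)|\ge k$, so that the edge density $p=e(H)/\binom nk$ is defined. For $S\subseteq V(H)$, let $e(S)$ be the number of edges of $H$ contained in $S$. The graded discrepancy of $H$ is $$\operatorname{grdisc}(H)=\min_{v_1,\dots,v_n}\ \max_{1\le i\le n}\left|e(\{v_1,\dots,v_i\})-p\binom ik\right|,$$ where the minimum is over all orderings $v_1,\dots,v_n$ of the vertices of $H$. For fixed $k$, and for $n$ and $p$ such that $p\binom nk$ is an integer, $c(p,n)$ is the maximum of $\operatorname{grdisc}(H)$ over all $k$-uniform hypergraphs $H$ with $n$ vertices and exactly $p\binom nk$ edges. *)

theory Defs
  imports Complex_Main "HOL-Combinatorics.Multiset_Permutations"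
begin

definition uniform_hypergraph :: "nat \<Rightarrow> 'a set \<Rightarrow> 'a set set \<Rightarrow> bool" where
  "uniform_hypergraph k V E \<longleftrightarrow> finite V \<and> E \<subseteq> {e. e \<subseteq> V \<and> card e = k}"

definition edges_within :: "'a set set \<Rightarrow> 'a set \<Rightarrow> nat" where
  "edges_within E S = card {e \<in> E. e \<subseteq> S}"

definition edge_density :: "nat \<Rightarrow> 'a set \<Rightarrow> 'a set set \<Rightarrow> real" where
  "edge_density k V E = real (card E) / real (card V choose k)"

text \<open>
  Orderings of the vertices are the duplicate-free lists \<open>vs\<close> with \<open>set vs = V\<close>; the vertices
  \<open>v\<^sub>1, \<dots>, v\<^sub>i\<close> form \<open>set (take i vs)\<close>.  For finite nonempty \<open>V\<close>, both the minimum
  and the maximum are over finite nonempty sets.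
\<close>
definition grdisc :: "nat \<Rightarrow> 'a set \<Rightarrow> 'a set set \<Rightarrow> real" where
  "grdisc k V E =
     (MIN vs \<in> permutations_of_set V.
        MAX i \<in> {1..card V}.
          \<bar>real (edges_within E (set (take i vs))) - edge_density k V E * real (i choose k)\<bar>)"

text \<open>
  The vertices are taken to be natural numbers, which represents every hypergraph up to isomorphism;
  see \<open>grdisc_le_max_grdisc\<close> below.  The set has a maximum whenever \<open>1 \<le> n\<close>,
  \<open>0 \<le> p \<le> 1\<close> and \<open>p * (n choose k)\<close> is an integer.
\<close>
definition max_grdisc :: "nat \<Rightarrow> real \<Rightarrow> nat \<Rightarrow> real" where
  "max_grdisc k p n =
     Max {grdisc k V E | (V :: nat set) E.
            uniform_hypergraph k V E \<and> card V = n \<and> real (card E) = p * real (n choose k)}"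

lemma grdisc_cong_iso:
  fixes V :: "'a set" and f :: "'a \<Rightarrow> 'b"
  assumes H: "uniform_hypergraph k V E" and f: "inj_on f V"
  shows "uniform_hypergraph k (f ` V) ((`) f ` E)"
    and "card ((`) f ` E) = card E"
    and "grdisc k (f ` V) ((`) f ` E) = grdisc k V E"
proof -
  have EV: "\<And>e. e \<in> E \<Longrightarrow> e \<subseteq> V" and fin: "finite V"
    using H by (auto simp: uniform_hypergraph_def)
  have inj: "inj_on ((`) f) (Pow V)"
    using f by (rule inj_on_image_Pow)
  show "uniform_hypergraph k (f ` V) ((`) f ` E)"
  proof -
    have "card (f ` e) = k" if "e \<in> E" for e
      using H EV[OF that] that inj_on_subset[OF f] card_image[of f e]
      by (auto simp: uniform_hypergraph_def)
    with fin EV show ?thesis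
      unfolding uniform_hypergraph_def by blast
  qed
  show cE: "card ((`) f ` E) = card E"
    using inj EV by (intro card_image) (auto intro: inj_on_subset)
  have cV: "card (f ` V) = card V"
    using f by (rule card_image)
  have ew: "edges_within ((`) f ` E) (f ` S) = edges_within E S" if "S \<subseteq> V" for S
  proof -
    have "{e \<in> (`) f ` E. e \<subseteq> f ` S} = (`) f ` {e \<in> E. e \<subseteq> S}"
    proof -
      have "f ` e \<subseteq> f ` S \<longleftrightarrow> e \<subseteq> S" if "e \<in> E" for e
        using inj_on_image_mem_iff[OF f] EV[OF that] \<open>S \<subseteq> V\<close> by blast
      then show ?thesis by blast
    qed
    moreover have "inj_on ((`) f) {e \<in> E. e \<subseteq> S}"
      using inj EV by (auto intro: inj_on_subset)
    ultimately show ?thesis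
      by (simp add: edges_within_def card_image)
  qed
  have perms: "permutations_of_set (f ` V) = map f ` permutations_of_set V"
    using f by (rule permutations_of_set_image_inj)
  show "grdisc k (f ` V) ((`) f ` E) = grdisc k V E"
    unfolding grdisc_def edge_density_def cE cV perms image_image
  proof (intro arg_cong[where f = Min] image_cong refl arg_cong[where f = Max])
    fix vs i assume "vs \<in> permutations_of_set V"
    then have "set (take i vs) \<subseteq> V"
      by (auto simp: permutations_of_set_def dest: in_set_takeD)
    then show "\<bar>real (edges_within ((`) f ` E) (set (take i (map f vs))))
        - real (card E) / real (card V choose k) * real (i choose k)\<bar>
      = \<bar>real (edges_within E (set (take i vs)))
        - real (card E) / real (card V choose k) * real (i choose k)\<bar>"
      by (simp add: take_map ew)
  qed
qed

lemma finite_grdisc_values: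
  shows "finite {grdisc k V E | (V :: nat set) E.
            uniform_hypergraph k V E \<and> card V = n \<and> real (card E) = p * real (n choose k)}"
    (is "finite ?A")
proof (rule finite_subset)
  let ?B = "(\<lambda>E. grdisc k {..<n} E) ` Pow (Pow {..<n})"
  show "finite ?B"
    by simp
  show "?A \<subseteq> ?B"
  proof clarify
    fix V :: "nat set" and E
    assume H: "uniform_hypergraph k V E" and n: "n = card V"
    obtain f where f: "bij_betw f V {..<n}"
      using H finite_same_card_bij[of V "{..<n}"] unfolding uniform_hypergraph_def n by auto
    then have inj: "inj_on f V" and im: "f ` V = {..<n}"
      by (auto simp: bij_betw_def)
    have "grdisc k V E = grdisc k {..<n} ((`) f ` E)"
      by (simp only: grdisc_cong_iso(3)[OF H inj] flip: im)
    moreover have "(`) f ` E \<in> Pow (Pow {..<n})"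
      using grdisc_cong_iso(1)[OF H inj] unfolding uniform_hypergraph_def im by blast
    ultimately show "grdisc k V E \<in> (\<lambda>E. grdisc k {..<card V} E) ` Pow (Pow {..<card V})"
      using n by blast
  qed
qed

lemma grdisc_le_max_grdisc:
  fixes V :: "'a set"
  assumes H: "uniform_hypergraph k V E"
    and p: "real (card E) = p * real (card V choose k)"
  shows "grdisc k V E \<le> max_grdisc k p (card V)"
proof -
  obtain f :: "'a \<Rightarrow> nat" where f: "inj_on f V"
    using H finite_imp_inj_to_nat_seg[of V] by (auto simp: uniform_hypergraph_def)
  note iso = grdisc_cong_iso[OF H f]
  have "grdisc k (f ` V) ((`) f ` E) \<le> max_grdisc k p (card V)"
    unfolding max_grdisc_def
  proof (rule Max_ge[OF finite_grdisc_values], intro CollectI exI conjI)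
    show "card (f ` V) = card V"
      using f by (rule card_image)
    show "real (card ((`) f ` E)) = p * real (card V choose k)"
      using p by (simp only: iso(2))
  qed (rule refl iso(1))+
  then show ?thesis
    by (simp add: iso(3))
qed

end

theory Submission
  imports Defs
begin

text \<open>
  Write \<open>D S = e(S) - p * (card S choose k)\<close> for the discrepancy of a vertex set \<open>S\<close>, and let
  \<open>m = (n - 1) choose (k - 1)\<close>.  An ordering is built from its end: starting with \<open>D V = 0\<close>,
  vertices are deleted one at a time, each chosen to suit the current value of \<open>D\<close>.

  Two facts govern a deletion.  Removing \<open>v\<close> from \<open>S\<close> destroys between \<open>0\<close> and
  \<open>(card S - 1) choose (k - 1)\<close> edges, so \<open>D\<close> rises by at most \<open>p * m\<close> and falls by at most
  \<open>(1 - p) * m\<close> (\<open>discrepancy_delete_bounds\<close>).  Over all \<open>v \<in> S\<close>, the average of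
  \<open>D (S - {v})\<close> is \<open>D S\<close> shrunk towards \<open>0\<close> (\<open>sum_discrepancy_delete\<close>), so some deletion makes
  \<open>D\<close> no smaller than \<open>min 0 (D S)\<close>, and some makes it no larger than \<open>max 0 (D S)\<close>.

  Put the threshold \<open>t = (1/2 - p) * m\<close>.  If \<open>D S \<le> t\<close>, use a deletion of the first kind: the new
  value is at most \<open>t + p * m = m / 2\<close>.  If \<open>D S > t\<close>, use one of the second kind: the new value
  is at least \<open>t - (1 - p) * m = - m / 2\<close>.  In both cases the opposite bound persists from \<open>S\<close>, so
  \<open>\<bar>D\<bar> \<le> m / 2\<close> throughout.  Hence \<open>grdisc k V E \<le> m / 2\<close> (\<open>grdisc_le_half\<close>), and each of
  \<open>(1 + p) / 2\<close>, \<open>max p (1 - p)\<close> and \<open>1 - p / 2\<close> is at least \<open>1 / 2\<close>.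
\<close>

section \<open>How a vertex deletion changes the discrepancy\<close>

definition discrepancy :: "nat \<Rightarrow> real \<Rightarrow> 'a set set \<Rightarrow> 'a set \<Rightarrow> real" where
  "discrepancy k p E S = real (edges_within E S) - p * real (card S choose k)"

text \<open>An edge inside \<open>S\<close> survives exactly the \<open>card S - k\<close> deletions of a vertex outside it.\<close>

lemma sum_edges_within_delete:
  assumes H: "uniform_hypergraph k V E" and S: "S \<subseteq> V"
  shows "(\<Sum>v\<in>S. edges_within E (S - {v})) = (card S - k) * edges_within E S"
proof -
  have finV: "finite V" and EV: "\<And>e. e \<in> E \<Longrightarrow> e \<subseteq> V \<and> card e = k"
    using H by (auto simp: uniform_hypergraph_def)
  have finS: "finite S"
    using S finV by (rule finite_subset)
  have finE: "finite E"
    by (rule finite_subset[of _ "Pow V"]) (use EV finV in auto)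
  let ?F = "{e \<in> E. e \<subseteq> S}"
  have finF: "finite ?F"
    using finE by simp
  have "(\<Sum>v\<in>S. edges_within E (S - {v})) = (\<Sum>v\<in>S. card {e \<in> ?F. v \<notin> e})"
    unfolding edges_within_def
    by (intro sum.cong refl arg_cong[where f = card]) auto
  also have "\<dots> = (\<Sum>e\<in>?F. card {v \<in> S. v \<notin> e})"
    using sum_multicount_gen[OF finS finF, of "\<lambda>v e. v \<notin> e" "\<lambda>e. card {v \<in> S. v \<notin> e}"] by simp
  also have "\<dots> = (\<Sum>e\<in>?F. card S - k)"
  proof (rule sum.cong[OF refl])
    fix e assume e: "e \<in> ?F"
    then have "{v \<in> S. v \<notin> e} = S - e" by auto
    then show "card {v \<in> S. v \<notin> e} = card S - k"
      using e EV finS by (auto simp: card_Diff_subset finite_subset)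
  qed
  finally show ?thesis
    by (simp add: edges_within_def)
qed

text \<open>
  The two counts scale alike because \<open>s * ((s - 1) choose k) = (s - k) * (s choose k)\<close>.  When
  \<open>card S < k\<close> the truncated factor \<open>card S - k\<close> is \<open>0\<close>, and so is every summand.
\<close>

lemma sum_discrepancy_delete:
  assumes H: "uniform_hypergraph k V E" and S: "S \<subseteq> V"
  shows "(\<Sum>v\<in>S. discrepancy k p E (S - {v})) = real (card S - k) * discrepancy k p E S"
proof -
  have "(\<Sum>v\<in>S. discrepancy k p E (S - {v}))
      = real (\<Sum>v\<in>S. edges_within E (S - {v})) - p * (\<Sum>v\<in>S. real (card (S - {v}) choose k))"
    by (simp add: discrepancy_def sum_subtractf sum_distrib_left of_nat_sum del: card_Diff_insert)
  also have "(\<Sum>v\<in>S. real (card (S - {v}) choose k)) = real (card S * ((card S - 1) choose k))"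
    by simp
  also have "\<dots> = real ((card S - k) * (card S choose k))"
    by (simp only: binomial_absorb_comp)
  also note sum_edges_within_delete[OF H S]
  finally show ?thesis
    by (simp only: discrepancy_def of_nat_mult right_diff_distrib mult.left_commute)
qed

text \<open>The edges lost with \<open>v\<close> are determined by the \<open>k - 1\<close> other vertices that they have in \<open>S\<close>.\<close>

lemma edges_within_le_delete:
  assumes H: "uniform_hypergraph k V E" and S: "S \<subseteq> V" and v: "v \<in> S"
  shows "edges_within E S \<le> edges_within E (S - {v}) + ((card S - 1) choose (k - 1))"
proof -
  have finV: "finite V" and EV: "\<And>e. e \<in> E \<Longrightarrow> e \<subseteq> V \<and> card e = k"
    using H by (auto simp: uniform_hypergraph_def)
  have finS: "finite S"
    using S finV by (rule finite_subset)
  let ?L = "{e \<in> E. e \<subseteq> S \<and> v \<in> e}"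
  let ?K = "{e. e \<subseteq> S - {v} \<and> card e = k - 1}"
  have "{e \<in> E. e \<subseteq> S} = {e \<in> E. e \<subseteq> S - {v}} \<union> ?L"
    by auto
  then have "edges_within E S \<le> edges_within E (S - {v}) + card ?L"
    unfolding edges_within_def by (simp only: card_Un_le)
  also have "card ?L \<le> card ?K"
  proof (rule card_inj_on_le)
    show "inj_on (\<lambda>e. e - {v}) ?L"
      by (rule inj_onI) (metis (no_types, lifting) insert_Diff mem_Collect_eq)
    show "(\<lambda>e. e - {v}) ` ?L \<subseteq> ?K"
      using EV by auto
    show "finite ?K"
      using finS by simp
  qed
  also have "card ?K = (card S - 1) choose (k - 1)"
    using finS v by (simp add: n_subsets)
  finally show ?thesis by simp
qed

text \<open>
  By Pascal's rule the subtracted term falls by exactly \<open>p * ((card S - 1) choose (k - 1))\<close>; a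
  deletion that destroys no edge gives the first bound, and one that destroys as many as possible
  gives the second.
\<close>

lemma discrepancy_delete_bounds:
  assumes H: "uniform_hypergraph k V E" and S: "S \<subseteq> V" and v: "v \<in> S"
    and k: "0 < k" and p: "0 \<le> p" "p \<le> 1"
  defines "m \<equiv> real ((card V - 1) choose (k - 1))"
  shows "discrepancy k p E (S - {v}) \<le> discrepancy k p E S + p * m"
    and "discrepancy k p E S - (1 - p) * m \<le> discrepancy k p E (S - {v})"
proof -
  have finV: "finite V" and EV: "\<And>e. e \<in> E \<Longrightarrow> e \<subseteq> V"
    using H by (auto simp: uniform_hypergraph_def)
  have finS: "finite S"
    using S finV by (rule finite_subset)
  have finE: "finite E"
    by (rule finite_subset[of _ "Pow V"]) (use EV finV in auto)
  let ?c = "real ((card S - 1) choose (k - 1))"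
  have cS: "0 < card S"
    using v finS card_gt_0_iff by blast
  have "card S choose k = ((card S - 1) choose (k - 1)) + ((card S - 1) choose k)"
    using cS k by (rule choose_reduce_nat)
  then have pascal: "discrepancy k p E (S - {v}) - discrepancy k p E S
      = real (edges_within E (S - {v})) - real (edges_within E S) + p * ?c"
    using v by (simp add: discrepancy_def algebra_simps)
  have "card S \<le> card V"
    using finV S by (rule card_mono)
  then have c: "?c \<le> m"
    unfolding m_def of_nat_le_iff by (intro binomial_right_mono) simp
  have "edges_within E (S - {v}) \<le> edges_within E S"
    unfolding edges_within_def using finE by (intro card_mono) auto
  moreover have "p * ?c \<le> p * m"
    using c p by (intro mult_left_mono)
  ultimately show "discrepancy k p E (S - {v}) \<le> discrepancy k p E S + p * m"
    using pascal by linarith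
  have "real (edges_within E S) \<le> real (edges_within E (S - {v})) + ?c"
    using edges_within_le_delete[OF H S v] by linarith
  moreover have "(1 - p) * ?c \<le> (1 - p) * m"
    using c p by (intro mult_left_mono) auto
  ultimately show "discrepancy k p E S - (1 - p) * m \<le> discrepancy k p E (S - {v})"
    using pascal by (simp add: algebra_simps)
qed

section \<open>Orderings with small prefix discrepancies\<close>

text \<open>
  The average of \<open>f\<close> lies between \<open>0\<close> and \<open>x\<close>, so not every value is below both.
\<close>

lemma exists_ge_min_of_sum_eq:
  fixes f :: "'a \<Rightarrow> real"
  assumes fin: "finite S" and ne: "S \<noteq> {}"
    and sum: "sum f S = c * x" and c: "0 \<le> c" "c \<le> real (card S)"
  shows "\<exists>v\<in>S. min 0 x \<le> f v"
proof (rule ccontr)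
  assume "\<not> ?thesis"
  then have "sum f S < (\<Sum>v\<in>S. min 0 x)"
    using fin ne by (intro sum_strict_mono) auto
  also have "\<dots> = real (card S) * min 0 x"
    by simp
  also have "\<dots> \<le> c * min 0 x"
    using c by (intro mult_right_mono_neg) auto
  also have "\<dots> \<le> c * x"
    using c by (intro mult_left_mono) auto
  finally show False
    using sum by simp
qed

text \<open>
  The threshold \<open>(1/2 - p) * m\<close> is where the largest possible rise \<open>p * m\<close> reaches \<open>m / 2\<close> and the
  largest possible fall \<open>(1 - p) * m\<close> reaches \<open>- m / 2\<close>.
\<close>

lemma exists_balanced_deletion:
  assumes H: "uniform_hypergraph k V E" and S: "S \<subseteq> V" and ne: "S \<noteq> {}"
    and k: "0 < k" and p: "0 \<le> p" "p \<le> 1"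
  defines "m \<equiv> real ((card V - 1) choose (k - 1))"
  assumes D: "\<bar>discrepancy k p E S\<bar> \<le> m / 2"
  shows "\<exists>v\<in>S. \<bar>discrepancy k p E (S - {v})\<bar> \<le> m / 2"
proof -
  let ?D = "discrepancy k p E"
  have finS: "finite S"
    using H S by (auto simp: uniform_hypergraph_def intro: finite_subset)
  have sum: "(\<Sum>v\<in>S. ?D (S - {v})) = real (card S - k) * ?D S"
    by (rule sum_discrepancy_delete[OF H S])
  have m: "0 \<le> m"
    by (simp add: m_def)
  note bounds = discrepancy_delete_bounds[OF H S _ k p, folded m_def]
  show ?thesis
  proof (cases "?D S \<le> (1/2 - p) * m")
    case True
    obtain v where v: "v \<in> S" "min 0 (?D S) \<le> ?D (S - {v})"
      using exists_ge_min_of_sum_eq[OF finS ne sum] by auto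
    have "?D (S - {v}) \<le> m / 2"
      using bounds(1)[OF v(1)] True by (simp add: algebra_simps)
    moreover have "- (m / 2) \<le> ?D (S - {v})"
      using v(2) D m by linarith
    ultimately show ?thesis
      using v(1) by (intro bexI[of _ v]) linarith+
  next
    case False
    have neg_sum: "(\<Sum>v\<in>S. - ?D (S - {v})) = real (card S - k) * - ?D S"
      using sum by (simp add: sum_negf)
    obtain v where v: "v \<in> S" "min 0 (- ?D S) \<le> - ?D (S - {v})"
      using exists_ge_min_of_sum_eq[OF finS ne neg_sum] by auto
    have "- (m / 2) \<le> ?D (S - {v})"
      using bounds(2)[OF v(1)] False by (simp add: algebra_simps)
    moreover have "?D (S - {v}) \<le> m / 2"
      using v(2) D m by linarith
    ultimately show ?thesis
      using v(1) by (intro bexI[of _ v]) linarith+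
  qed
qed

text \<open>Each deleted vertex is put at the end of the ordering found for the set that remains.\<close>

lemma exists_ordering_by_deletion:
  assumes "finite S" and "P S"
    and "\<And>T. T \<subseteq> S \<Longrightarrow> T \<noteq> {} \<Longrightarrow> P T \<Longrightarrow> \<exists>v\<in>T. P (T - {v})"
  shows "\<exists>vs\<in>permutations_of_set S. \<forall>i. P (set (take i vs))"
  using assms
proof (induction S rule: finite_remove_induct)
  case empty
  then show ?case by simp
next
  case (remove S)
  obtain v where v: "v \<in> S" "P (S - {v})"
    using remove by blast
  obtain vs where vs: "vs \<in> permutations_of_set (S - {v})" "\<And>i. P (set (take i vs))"
    using remove.IH[OF v] remove.prems(2) by (meson Diff_subset subset_trans)
  have perm: "vs @ [v] \<in> permutations_of_set S"
    using vs(1) v(1) by (auto simp: permutations_of_set_def)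
  have "P (set (take i (vs @ [v])))" for i
  proof (cases "i \<le> length vs")
    case True
    then show ?thesis using vs(2) by simp
  next
    case False
    then have "set (take i (vs @ [v])) = S"
      using perm by (simp add: permutations_of_set_def)
    then show ?thesis using remove.prems(1) by simp
  qed
  then show ?case using perm by blast
qed

theorem grdisc_le_half:
  assumes H: "uniform_hypergraph k V E" and k: "0 < k" "k \<le> card V"
  shows "grdisc k V E \<le> real ((card V - 1) choose (k - 1)) / 2"
proof -
  define p where "p = edge_density k V E"
  define m where "m = real ((card V - 1) choose (k - 1))"
  have finV: "finite V" and EV: "E \<subseteq> {e. e \<subseteq> V \<and> card e = k}"
    using H by (auto simp: uniform_hypergraph_def)
  have "card E \<le> card {e. e \<subseteq> V \<and> card e = k}"
    using EV finV by (intro card_mono) auto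
  then have cE: "card E \<le> card V choose k"
    using finV by (simp add: n_subsets)
  have pos: "0 < card V choose k"
    using k(2) by simp
  have p: "0 \<le> p" "p \<le> 1"
    using cE pos by (auto simp: p_def edge_density_def divide_le_eq)
  have "{e \<in> E. e \<subseteq> V} = E"
    using EV by auto
  then have "discrepancy k p E V = 0"
    using pos by (simp add: discrepancy_def p_def edge_density_def edges_within_def)
  then have start: "\<bar>discrepancy k p E V\<bar> \<le> m / 2"
    by (simp add: m_def)
  obtain vs where vs: "vs \<in> permutations_of_set V"
      "\<And>i. \<bar>discrepancy k p E (set (take i vs))\<bar> \<le> m / 2"
    using exists_ordering_by_deletion[of V "\<lambda>S. \<bar>discrepancy k p E S\<bar> \<le> m / 2",
        OF finV start exists_balanced_deletion[OF H _ _ k(1) p, folded m_def]] by auto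
  let ?f = "\<lambda>vs i. \<bar>real (edges_within E (set (take i vs))) - p * real (i choose k)\<bar>"
  have "grdisc k V E \<le> (MAX i \<in> {1..card V}. ?f vs i)"
    unfolding grdisc_def p_def using vs(1) by (intro Min_le) auto
  also have "\<dots> \<le> m / 2"
  proof (rule Max.boundedI)
    fix x assume "x \<in> ?f vs ` {1..card V}"
    then obtain i where i: "i \<le> card V" and x: "x = ?f vs i"
      by auto
    have "card (set (take i vs)) = i"
      using vs(1) i
      by (subst distinct_card) (auto simp: permutations_of_set_def distinct_card)
    then show "x \<le> m / 2"
      using vs(2)[of i] x by (simp add: discrepancy_def)
  qed (use k in auto)
  finally show ?thesis
    by (simp add: m_def)
qed

section \<open>The maximal graded discrepancy\<close>

text \<open>The maximum defining \<open>max_grdisc\<close> is over a nonempty set, so bounds on \<open>grdisc\<close> pass to it.\<close>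

lemma exists_uniform_hypergraph:
  assumes "0 \<le> p" "p \<le> 1" and "p * real (n choose k) \<in> \<int>"
  shows "\<exists>(V :: nat set) E. uniform_hypergraph k V E \<and> card V = n
           \<and> real (card E) = p * real (n choose k)"
proof -
  have "p * real (n choose k) \<in> \<nat>"
    using assms by (simp add: Nats_altdef2)
  then obtain N where N: "p * real (n choose k) = real N"
    by (auto elim: Nats_cases)
  let ?K = "{e. e \<subseteq> {..<n} \<and> card e = k}"
  have "real N \<le> real (n choose k)"
    using assms(2) N by (metis mult_left_le_one_le assms(1) of_nat_0_le_iff)
  then have "N \<le> card ?K"
    by (simp add: n_subsets)
  then obtain E where "E \<subseteq> ?K" "card E = N"
    by (meson obtain_subset_with_card_n)
  then show ?thesis
    using N by (intro exI[of _ "{..<n}"] exI[of _ E]) (auto simp: uniform_hypergraph_def)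
qed

theorem theorem1p5:
  fixes k n :: nat and p :: real
  assumes "2 \<le> k" and "k \<le> n" and "0 < p" and "p < 1"
  shows "(\<forall>(V :: 'a set) E.
            uniform_hypergraph k V E \<and> card V = n \<and> real (card E) = p * real (n choose k) \<longrightarrow>
            grdisc k V E \<le>
              (if p < 1/3 then (1 + p) / 2 * real ((n - 1) choose (k - 1))
               else if p \<le> 2/3 then max p (1 - p) * real ((n - 1) choose (k - 1))
               else (1 - p / 2) * real ((n - 1) choose (k - 1)))) \<and>
         (p * real (n choose k) \<in> \<int> \<longrightarrow>
            max_grdisc k p n \<le>
              (if p < 1/3 then (1 + p) / 2 * real ((n - 1) choose (k - 1))
               else if p \<le> 2/3 then max p (1 - p) * real ((n - 1) choose (k - 1))
               else (1 - p / 2) * real ((n - 1) choose (k - 1))))"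
proof -
  define m where "m = real ((n - 1) choose (k - 1))"
  define b where "b = (if p < 1/3 then (1 + p) / 2 * m
               else if p \<le> 2/3 then max p (1 - p) * m
               else (1 - p / 2) * m)"
  have "0 \<le> m"
    by (simp add: m_def)
  then have "1 / 2 * m \<le> (1 + p) / 2 * m" "1 / 2 * m \<le> max p (1 - p) * m"
      "1 / 2 * m \<le> (1 - p / 2) * m"
    using assms(3,4) by (intro mult_right_mono; simp add: max_def)+
  then have "1 / 2 * m \<le> b"
    by (simp only: b_def split: if_split) blast
  then have b: "x \<le> b" if "x \<le> m / 2" for x
    using that by linarith
  have bound: "grdisc k V E \<le> b" if "uniform_hypergraph k V E" "card V = n" for V :: "'a set" and E
    using grdisc_le_half[OF that(1)] that(2) assms(1,2) by (intro b) (simp add: m_def)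
  have bound_nat: "grdisc k V E \<le> b" if "uniform_hypergraph k V E" "card V = n" for V :: "nat set" and E
    using grdisc_le_half[OF that(1)] that(2) assms(1,2) by (intro b) (simp add: m_def)
  have "max_grdisc k p n \<le> b" if "p * real (n choose k) \<in> \<int>"
    unfolding max_grdisc_def
  proof (rule Max.boundedI[OF finite_grdisc_values])
    show "{grdisc k V E | (V :: nat set) E.
            uniform_hypergraph k V E \<and> card V = n \<and> real (card E) = p * real (n choose k)} \<noteq> {}"
      using exists_uniform_hypergraph[OF _ _ that] assms(3,4) by auto
  qed (use bound_nat in auto)
  then show ?thesis
    using bound unfolding b_def m_def by blast
qed

end
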